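(* Let $Q_{k_1}$ and $O_{k_2}$ be two hypercubes, of dimension $k_1$ and $k_2$ respectively, contained as subgraphs in a $d$-dimensional hypercube $Q_d$. Let $f$ be a proper edge coloring of $Q_{k_1} \cup O_{k_2}$ with colors from $\{1,\dots,d\}$ such that the restriction of $f$ to $Q_{k_1}$ is a proper edge coloring using exactly $k_1$ colors, forming a set $A_1 \subseteq \{1,\dots,d\}$, and the restriction of $f$ to $O_{k_2}$ is a proper edge coloring using exactly $k_2$ colors, forming a set $A_2 \subseteq \{1,\dots,d\}$. Then $f$ is extendable to a proper $d$-edge coloring of $Q_d$ unless all of the following hold: $Q_{k_1}$ and $O_{k_2}$ are disjoint, some vertex of $Q_{k_1}$ is adjacent (in $Q_d$) to a vertex of $O_{k_2}$, and $d \leq |A_1 \cup A_2|$.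
   Context: $Q_d$ is the $d$-dimensional hypercube graph. Disjoint means vertex-disjoint. A proper edge coloring of a graph assigns distinct colors to adjacent edges. A proper $d$-edge coloring uses colors from $\{1,\dots,d\}$. A proper edge coloring $f$ of a subgraph of $Q_d$ is extendable to a proper $d$-edge coloring of $Q_d$ if there is a proper $d$-edge coloring of $Q_d$ that agrees with $f$ on every edge colored under $f$. *)

theory Defs
  imports Main
begin

record 'a graph =
  verts :: "'a set"
  edges :: "'a set set"

definition subgraph :: "'a graph \<Rightarrow> 'a graph \<Rightarrow> bool" where
  "subgraph H G \<longleftrightarrow>
     verts H \<subseteq> verts G \<and> edges H \<subseteq> edges G \<and> (\<forall>e\<in>edges H. e \<subseteq> verts H)"

definition graph_union :: "'a graph \<Rightarrow> 'a graph \<Rightarrow> 'a graph" where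
  "graph_union G H = \<lparr>verts = verts G \<union> verts H, edges = edges G \<union> edges H\<rparr>"

definition isomorphic :: "'a graph \<Rightarrow> 'b graph \<Rightarrow> bool" where
  "isomorphic G H \<longleftrightarrow>
     (\<exists>\<phi>. bij_betw \<phi> (verts G) (verts H) \<and>
          (\<forall>u\<in>verts G. \<forall>v\<in>verts G. {u, v} \<in> edges G \<longleftrightarrow> {\<phi> u, \<phi> v} \<in> edges H))"

definition hypercube :: "nat \<Rightarrow> bool list graph" where
  "hypercube n =
     \<lparr>verts = {x. length x = n},
      edges = {{x, y} | x y. length x = n \<and> length y = n \<and>
                             card {i. i < n \<and> x ! i \<noteq> y ! i} = 1}\<rparr>"

(* A colouring is a total function on vertex sets; only its values on the
   edges of the graph under consideration matter. *)
definition proper_edge_coloring :: "'a graph \<Rightarrow> ('a set \<Rightarrow> nat) \<Rightarrow> bool" where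
  "proper_edge_coloring G f \<longleftrightarrow>
     (\<forall>e\<in>edges G. \<forall>e'\<in>edges G. e \<noteq> e' \<and> e \<inter> e' \<noteq> {} \<longrightarrow> f e \<noteq> f e')"

definition proper_n_edge_coloring :: "nat \<Rightarrow> 'a graph \<Rightarrow> ('a set \<Rightarrow> nat) \<Rightarrow> bool" where
  "proper_n_edge_coloring n G f \<longleftrightarrow> proper_edge_coloring G f \<and> f ` edges G \<subseteq> {1..n}"

definition extendable :: "nat \<Rightarrow> bool list graph \<Rightarrow> (bool list set \<Rightarrow> nat) \<Rightarrow> bool" where
  "extendable d H f \<longleftrightarrow>
     (\<exists>g. proper_n_edge_coloring d (hypercube d) g \<and> (\<forall>e\<in>edges H. g e = f e))"

end

theory Submission
  imports Defs
begin

text \<open>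
  A subgraph of \<open>Q\<^sub>d\<close> isomorphic to a cube is a subcube: all vertices obtained from a base point by
  changing coordinates in a set \<open>D\<close> of directions. This is lemma \<open>hypercube_copy_is_subcube\<close>; it
  holds because opposite edges of a 4-cycle of \<open>Q\<^sub>d\<close> point in the same direction. A proper colouring
  of a \<open>k\<close>-dimensional subcube with exactly \<open>k\<close> colours shows every one of these colours at every
  vertex. Such a colouring extends easily to the whole cube: repeat it on all parallel copies of the
  subcube, and give each direction outside \<open>D\<close> a constant colour from the remaining ones
  (\<open>lift_factorization\<close>). Let now \<open>D\<^sub>1\<close>, \<open>A\<^sub>1\<close> and \<open>D\<^sub>2\<close>, \<open>A\<^sub>2\<close> be the directions and colours of the
  two subcubes.

  If the subcubes meet, then on the intersection the directions \<open>D\<^sub>1 \<inter> D\<^sub>2\<close> carry exactly the colours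
  \<open>A\<^sub>1 \<inter> A\<^sub>2\<close>. Extend the colouring of the second subcube as above, sending the directions in
  \<open>D\<^sub>1 - D\<^sub>2\<close> to the colours in \<open>A\<^sub>1 - A\<^sub>2\<close>. The first subcube then receives precisely the colours \<open>A\<^sub>1\<close>,
  and its colouring may be exchanged for any other one with the same colours (\<open>extend_meeting\<close>).

  If the subcubes are disjoint, they are separated by some direction \<open>\<delta>\<close> outside \<open>D\<^sub>1 \<union> D\<^sub>2\<close>. When
  some colour avoids \<open>A\<^sub>1 \<union> A\<^sub>2\<close>, all edges in direction \<open>\<delta>\<close> take it, and the two halves of the cube
  are coloured independently. When there is no such colour, the subcubes are not adjacent, so there
  is a second separating direction \<open>\<epsilon>\<close>. The two directions cut the cube into four quarters, arranged
  in a 4-cycle, with the two subcubes in opposite quarters. As \<open>A\<^sub>1\<close> and \<open>A\<^sub>2\<close> both omit at least two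
  colours, the two bundles of edges leaving the first subcube's quarter can take colours outside \<open>A\<^sub>1\<close>
  and the other two bundles colours outside \<open>A\<^sub>2\<close>. These are four different colours because
  \<open>A\<^sub>1 \<union> A\<^sub>2\<close> is everything. Again the quarters are coloured independently. Both cases are instances
  of \<open>extend_across_cut\<close>.
\<close>

section \<open>Flips, subcubes and the edges of the hypercube\<close>

definition flip :: "bool list \<Rightarrow> nat \<Rightarrow> bool list" where
  "flip x i = x[i := \<not> x ! i]"

definition subcube :: "bool list \<Rightarrow> nat set \<Rightarrow> bool list set" where
  "subcube a D = {x. length x = length a \<and> (\<forall>i<length a. i \<notin> D \<longrightarrow> x ! i = a ! i)}"

definition project :: "bool list \<Rightarrow> nat set \<Rightarrow> bool list \<Rightarrow> bool list" where
  "project a D x = map (\<lambda>i. if i \<in> D then x ! i else a ! i) [0..<length a]"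

text \<open>
  An edge is addressed by an endpoint \<open>x\<close> and a direction \<open>i\<close>, and \<open>h x i\<close> is its colour. The second
  conjunct says that both endpoints agree on the colour; the first one combines properness at \<open>x\<close>
  with the requirement that every colour of \<open>C\<close> occurs there, so the colour classes are perfect
  matchings.
\<close>

definition factorization ::
    "bool list set \<Rightarrow> nat set \<Rightarrow> nat set \<Rightarrow> (bool list \<Rightarrow> nat \<Rightarrow> nat) \<Rightarrow> bool" where
  "factorization V D C h \<longleftrightarrow>
     (\<forall>x\<in>V. bij_betw (h x) D C \<and> (\<forall>i\<in>D. h (flip x i) i = h x i))"

text \<open>
  The extension of a colouring of a subcube to parallel copies of it, with the constant colour
  \<open>\<pi> i\<close> on each direction \<open>i\<close> transversal to the subcube.
\<close>

definition lift ::
    "bool list \<Rightarrow> nat set \<Rightarrow> (bool list \<Rightarrow> nat \<Rightarrow> nat) \<Rightarrow> (nat \<Rightarrow> nat) \<Rightarrow> bool list \<Rightarrow> nat \<Rightarrow> nat" where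
  "lift a D h \<pi> x i = (if i \<in> D then h (project a D x) i else \<pi> i)"

lemma length_flip [simp]: "length (flip x i) = length x"
  by (simp add: flip_def)

lemma nth_flip: "i < length x \<Longrightarrow> flip x i ! j = (if j = i then \<not> x ! j else x ! j)"
  by (auto simp: flip_def nth_list_update)

lemma nth_flip_neq [simp]: "j \<noteq> i \<Longrightarrow> flip x i ! j = x ! j"
  by (simp add: flip_def)

lemma flip_flip [simp]: "flip (flip x i) i = x"
  by (cases "i < length x") (simp_all add: flip_def list_update_beyond)

lemma flip_inject: "i < length x \<Longrightarrow> flip x i = flip x j \<longleftrightarrow> i = j"
  by (metis nth_flip nth_flip_neq)

lemma hypercube_adjacent_iff:
  assumes "length x = d"
  shows "{x, y} \<in> edges (hypercube d) \<longleftrightarrow> (\<exists>i<d. y = flip x i)"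
proof
  assume "{x, y} \<in> edges (hypercube d)"
  then obtain u v where uv: "{x, y} = {u, v}" "length u = d" "length v = d"
    "card {i. i < d \<and> u ! i \<noteq> v ! i} = 1"
    by (auto simp: hypercube_def)
  have len: "length y = d" using uv by (auto simp: doubleton_eq_iff)
  have "{i. i < d \<and> u ! i \<noteq> v ! i} = {i. i < d \<and> x ! i \<noteq> y ! i}"
    using uv(1) by (auto simp: doubleton_eq_iff)
  then obtain i where i: "{i. i < d \<and> x ! i \<noteq> y ! i} = {i}"
    using uv(4) by (auto simp: card_1_singleton_iff)
  then have "i < d" by auto
  moreover have "y = flip x i"
  proof (rule nth_equalityI)
    fix j assume "j < length y"
    then show "y ! j = flip x i ! j"
      using i len assms \<open>i < d\<close> by (cases "j = i") (auto simp: nth_flip)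
  qed (use len assms in simp)
  ultimately show "\<exists>i<d. y = flip x i" by blast
next
  assume "\<exists>i<d. y = flip x i"
  then obtain i where i: "i < d" "y = flip x i" by blast
  then have "{j. j < d \<and> x ! j \<noteq> y ! j} = {i}"
    using assms by (auto simp: nth_flip)
  then have "card {j. j < d \<and> x ! j \<noteq> y ! j} = 1" by simp
  moreover have "length y = d" using assms i by simp
  ultimately show "{x, y} \<in> edges (hypercube d)"
    using assms by (simp only: hypercube_def graph.simps mem_Collect_eq) blast
qed

lemma edges_hypercube:
  "edges (hypercube d) = {{x, flip x i} | x i. length x = d \<and> i < d}"
proof (intro set_eqI iffI)
  fix e assume e: "e \<in> edges (hypercube d)"
  then obtain x y where xy: "e = {x, y}" "length x = d"
    by (auto simp: hypercube_def)
  then obtain i where "i < d" "y = flip x i"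
    using e hypercube_adjacent_iff by blast
  then show "e \<in> {{x, flip x i} | x i. length x = d \<and> i < d}"
    using xy by blast
next
  fix e assume "e \<in> {{x, flip x i} | x i. length x = d \<and> i < d}"
  then show "e \<in> edges (hypercube d)"
    using hypercube_adjacent_iff by blast
qed

lemma base_in_subcube [simp]: "a \<in> subcube a D"
  by (simp add: subcube_def)

lemma length_subcube: "x \<in> subcube a D \<Longrightarrow> length x = length a"
  by (simp add: subcube_def)

lemma subcube_nth: "x \<in> subcube a D \<Longrightarrow> i < length a \<Longrightarrow> i \<notin> D \<Longrightarrow> x ! i = a ! i"
  by (simp add: subcube_def)

lemma subcube_full: "subcube a {..<length a} = {x. length x = length a}"
  by (auto simp: subcube_def)

lemma flip_in_subcube: "x \<in> subcube a D \<Longrightarrow> i \<in> D \<Longrightarrow> flip x i \<in> subcube a D"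
  by (auto simp: subcube_def) (metis nth_flip_neq)+

lemma subcube_rebase: "b \<in> subcube a D \<Longrightarrow> subcube b D = subcube a D"
  by (auto simp: subcube_def)

text \<open>Every point of a subcube is reached from the base point by flipping coordinates in \<open>D\<close>.\<close>

lemma subcube_induct [consumes 1, case_names base flip]:
  assumes "x \<in> subcube a D"
    and base: "P a"
    and step: "\<And>y i. y \<in> subcube a D \<Longrightarrow> i < length a \<Longrightarrow> i \<in> D \<Longrightarrow> P y \<Longrightarrow> P (flip y i)"
  shows "P x"
  using assms(1)
proof (induction "card {i. i < length a \<and> x ! i \<noteq> a ! i}" arbitrary: x rule: less_induct)
  case less
  show ?case
  proof (cases "x = a")
    case True then show ?thesis using base by simp
  next
    case False
    then obtain i where i: "i < length a" "x ! i \<noteq> a ! i"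
      using nth_equalityI[of x a] length_subcube[OF less.prems] by auto
    then have iD: "i \<in> D" using less.prems subcube_nth by blast
    let ?y = "flip x i"
    have y: "?y \<in> subcube a D" using less.prems iD by (rule flip_in_subcube)
    have "{j. j < length a \<and> ?y ! j \<noteq> a ! j} \<subset> {j. j < length a \<and> x ! j \<noteq> a ! j}"
      using i length_subcube[OF less.prems] by (auto simp: nth_flip split: if_splits)
    then have "card {j. j < length a \<and> ?y ! j \<noteq> a ! j} < card {j. j < length a \<and> x ! j \<noteq> a ! j}"
      by (intro psubset_card_mono) auto
    then have "P ?y" using less.hyps y by blast
    then have "P (flip ?y i)" using step y i iD by blast
    then show ?thesis by simp
  qed
qed

section \<open>Copies of a hypercube are subcubes\<close>

text \<open>
  The two paths are the two ways around a 4-cycle. Coordinate \<open>i\<close> is changed by the first path, so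
  the second path must change it too, and it does not do so in its first step.
\<close>

lemma opposite_directions_of_square:
  assumes "i < length x" "j < length x" "k < length x" "l < length x"
    and "flip (flip x i) j = flip (flip x k) l"
    and "i \<noteq> j" "i \<noteq> k"
  shows "i = l"
proof (rule ccontr)
  assume "i \<noteq> l"
  have "flip (flip x i) j ! i = (\<not> x ! i)" using assms(1,2,6) by (simp add: nth_flip)
  moreover have "flip (flip x k) l ! i = x ! i" using assms(1,3,4,7) \<open>i \<noteq> l\<close> by (simp add: nth_flip)
  ultimately show False using assms(5) by simp
qed

text \<open>
  An embedding sends each edge in direction \<open>i\<close> to an edge in some direction. Parallel edges
  joined by a 4-cycle get the same image direction, and any two parallel edges are linked by such
  4-cycles. Hence the image direction \<open>\<tau> i\<close> depends on \<open>i\<close> only, and the image is the subcube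
  spanned by the directions \<open>\<tau> i\<close>.
\<close>

lemma hypercube_copy_is_subcube:
  assumes sub: "subgraph Q (hypercube d)" and iso: "isomorphic (hypercube k) Q"
  obtains a D where "length a = d" "D \<subseteq> {..<d}" "card D = k" "verts Q = subcube a D"
    "edges Q = {{x, flip x i} | x i. x \<in> subcube a D \<and> i \<in> D}"
proof -
  obtain \<phi> where bij: "bij_betw \<phi> (verts (hypercube k)) (verts Q)"
    and adj: "\<And>u v. u \<in> verts (hypercube k) \<Longrightarrow> v \<in> verts (hypercube k) \<Longrightarrow>
               {u, v} \<in> edges (hypercube k) \<longleftrightarrow> {\<phi> u, \<phi> v} \<in> edges Q"
    using iso unfolding isomorphic_def by blast
  have V: "verts (hypercube n) = {x. length x = n}" for n
    by (simp add: hypercube_def)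
  have len: "length (\<phi> u) = d" if "length u = k" for u
    using that bij sub unfolding bij_betw_def subgraph_def V by blast
  have inj: "\<phi> u = \<phi> v \<longleftrightarrow> u = v" if "length u = k" "length v = k" for u v
    using that bij unfolding bij_betw_def V inj_on_def by blast
  have edge: "{\<phi> u, \<phi> (flip u i)} \<in> edges Q" if "length u = k" "i < k" for u i
    using adj[of u "flip u i"] that hypercube_adjacent_iff[of u k] by (auto simp: V)
  have "\<exists>j<d. \<phi> (flip u i) = flip (\<phi> u) j" if "length u = k" "i < k" for u i
    using edge[OF that] sub len[OF that(1)] hypercube_adjacent_iff unfolding subgraph_def by blast
  then obtain \<tau> where \<tau>: "\<And>u i. length u = k \<Longrightarrow> i < k \<Longrightarrow> \<tau> u i < d"
    "\<And>u i. length u = k \<Longrightarrow> i < k \<Longrightarrow> \<phi> (flip u i) = flip (\<phi> u) (\<tau> u i)"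
    by metis
  have \<tau>_inj: "\<tau> u i = \<tau> u j \<longleftrightarrow> i = j" if "length u = k" "i < k" "j < k" for u i j
    using \<tau>(2)[of u i] \<tau>(2)[of u j] that inj[of "flip u i" "flip u j"]
    by (metis flip_inject length_flip)
  have \<tau>_flip: "\<tau> (flip u j) i = \<tau> u i" if u: "length u = k" and ij: "i < k" "j < k" for u i j
  proof (cases "i = j")
    case True
    have "flip (flip (\<phi> u) (\<tau> u i)) (\<tau> (flip u i) i) = \<phi> u"
      using \<tau>(2)[of u i] \<tau>(2)[of "flip u i" i] u ij by simp
    then have "flip (flip (\<phi> u) (\<tau> u i)) (\<tau> (flip u i) i) = flip (flip (\<phi> u) (\<tau> u i)) (\<tau> u i)"
      by simp
    then show ?thesis
      using True flip_inject \<tau>(1) u ij len by (metis length_flip)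
  next
    case False
    have "flip (flip u i) j = flip (flip u j) i"
      using False by (simp add: flip_def list_update_swap)
    then have sq: "flip (flip (\<phi> u) (\<tau> u i)) (\<tau> (flip u i) j)
             = flip (flip (\<phi> u) (\<tau> u j)) (\<tau> (flip u j) i)"
      using \<tau>(2) u ij by (metis length_flip)
    have "flip (flip u i) j \<noteq> u"
      using False u ij by (metis flip_flip flip_inject length_flip)
    then have "\<phi> (flip (flip u i) j) \<noteq> \<phi> u" using inj u by simp
    then have ne: "\<tau> u i \<noteq> \<tau> (flip u i) j"
      using \<tau>(2) u ij by (metis length_flip flip_flip)
    show ?thesis
      using opposite_directions_of_square[OF _ _ _ _ sq ne] \<tau>(1) u ij len \<tau>_inj False
      by (metis length_flip)
  qed
  define z where "z = replicate k False"
  have z: "length z = k" by (simp add: z_def)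
  have \<tau>_const: "\<tau> u i = \<tau> z i" if "length u = k" "i < k" for u i
  proof -
    have "u \<in> subcube z {..<k}" using that z subcube_full[of z] by simp
    then show ?thesis
    proof (induction rule: subcube_induct)
      case (flip y j)
      then have "length y = k" "j < k" using z length_subcube by auto
      then show ?case using \<tau>_flip[of y i j] flip.IH that by simp
    qed simp
  qed
  define D where "D = \<tau> z ` {..<k}"
  have D: "D \<subseteq> {..<d}" using \<tau>(1) z by (auto simp: D_def)
  have "card D = k"
    unfolding D_def using \<tau>_inj z by (subst card_image) (auto simp: inj_on_def)
  have \<phi>_flip: "\<phi> (flip u i) = flip (\<phi> u) (\<tau> z i)" if "length u = k" "i < k" for u i
    using \<tau>(2) \<tau>_const that by simp
  have "verts Q \<subseteq> subcube (\<phi> z) D"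
  proof
    fix x assume "x \<in> verts Q"
    then obtain u where u: "length u = k" "x = \<phi> u"
      using bij unfolding bij_betw_def V by blast
    then have "u \<in> subcube z {..<k}" using z subcube_full[of z] by simp
    then have "\<phi> u \<in> subcube (\<phi> z) D"
    proof (induction rule: subcube_induct)
      case (flip y i)
      then have "length y = k" "i < k" using z length_subcube by auto
      then show ?case using flip_in_subcube flip.IH \<phi>_flip D_def by auto
    qed simp
    then show "x \<in> subcube (\<phi> z) D" using u by simp
  qed
  moreover have "subcube (\<phi> z) D \<subseteq> verts Q"
  proof
    fix x assume "x \<in> subcube (\<phi> z) D"
    then have "\<exists>u. length u = k \<and> x = \<phi> u"
    proof (induction rule: subcube_induct)
      case base then show ?case using z by blast
    next
      case (flip y j)
      then obtain u i where "length u = k" "y = \<phi> u" "i < k" "j = \<tau> z i" by (auto simp: D_def)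
      then have "length (flip u i) = k \<and> flip y j = \<phi> (flip u i)" using \<phi>_flip by simp
      then show ?case by blast
    qed
    then show "x \<in> verts Q" using bij unfolding bij_betw_def V by blast
  qed
  ultimately have vQ: "verts Q = subcube (\<phi> z) D" by blast
  have "edges Q = {{x, flip x i} | x i. x \<in> subcube (\<phi> z) D \<and> i \<in> D}"
  proof (intro set_eqI iffI)
    fix e assume e: "e \<in> edges Q"
    then have "e \<in> edges (hypercube d)" and eV: "e \<subseteq> verts Q"
      using sub unfolding subgraph_def by auto
    then obtain x j where x: "e = {x, flip x j}" "length x = d" "j < d"
      by (auto simp: edges_hypercube)
    obtain u v where uv: "length u = k" "length v = k" "x = \<phi> u" "flip x j = \<phi> v"
      using eV x bij unfolding bij_betw_def V by blast
    then have "{u, v} \<in> edges (hypercube k)" using adj[of u v] e x by (simp add: V)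
    then obtain i where i: "i < k" "v = flip u i" using hypercube_adjacent_iff uv by blast
    then have "flip x j = flip x (\<tau> z i)" using \<phi>_flip uv by simp
    then have "j = \<tau> z i" using flip_inject x by blast
    then have "j \<in> D" using i by (simp add: D_def)
    then show "e \<in> {{x, flip x i} | x i. x \<in> subcube (\<phi> z) D \<and> i \<in> D}"
      using x eV vQ by blast
  next
    fix e assume "e \<in> {{x, flip x i} | x i. x \<in> subcube (\<phi> z) D \<and> i \<in> D}"
    then obtain x j where x: "e = {x, flip x j}" "x \<in> verts Q" "j \<in> D" using vQ by blast
    then obtain u i where "length u = k" "x = \<phi> u" "i < k" "j = \<tau> z i"
      using bij unfolding bij_betw_def V D_def by blast
    then show "e \<in> edges Q" using edge \<phi>_flip x by metis
  qed
  then show thesis using that D \<open>card D = k\<close> vQ len z by blast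
qed

section \<open>Proper colourings and factorizations\<close>

lemma proper_edge_coloring_inj_at:
  assumes "proper_edge_coloring G f" and "\<And>i. i \<in> D \<Longrightarrow> {x, flip x i} \<in> edges G"
    and "D \<subseteq> {..<length x}"
  shows "inj_on (\<lambda>i. f {x, flip x i}) D"
proof (rule inj_onI, rule ccontr)
  fix i j assume ij: "i \<in> D" "j \<in> D" "f {x, flip x i} = f {x, flip x j}" "i \<noteq> j"
  have "i < length x" using ij(1) assms(3) by blast
  then have "flip x i \<noteq> flip x j" using ij(4) by (simp add: flip_inject)
  then have ne: "{x, flip x i} \<noteq> {x, flip x j}" by (auto simp: doubleton_eq_iff)
  have meet: "{x, flip x i} \<inter> {x, flip x j} \<noteq> {}" by simp
  show False
    using assms(1)[unfolded proper_edge_coloring_def, rule_format,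
        OF assms(2)[OF ij(1)] assms(2)[OF ij(2)] conjI[OF ne meet]] ij(3)
    by contradiction
qed

text \<open>
  Each vertex of the subcube has as many edges as there are colours, and these edges have distinct
  colours, so no colour is missing.
\<close>

lemma exact_coloring_factorization:
  assumes "proper_edge_coloring Q f" and D: "D \<subseteq> {..<length a}"
    and E: "edges Q = {{x, flip x i} | x i. x \<in> subcube a D \<and> i \<in> D}"
    and card: "card (f ` edges Q) = card D"
    and fin: "finite (f ` edges Q)"
  shows "factorization (subcube a D) D (f ` edges Q) (\<lambda>x i. f {x, flip x i})"
  unfolding factorization_def
proof (intro ballI conjI)
  fix x assume x: "x \<in> subcube a D"
  have edge: "{x, flip x i} \<in> edges Q" if "i \<in> D" for i
    unfolding E mem_Collect_eq using that x by (intro exI[of _ x] exI[of _ i]) simp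
  have inj: "inj_on (\<lambda>i. f {x, flip x i}) D"
  proof (rule proper_edge_coloring_inj_at[OF assms(1) edge])
    show "D \<subseteq> {..<length x}" using D length_subcube[OF x] by simp
  qed
  have "(\<lambda>i. f {x, flip x i}) ` D \<subseteq> f ` edges Q"
  proof (rule image_subsetI)
    fix i assume "i \<in> D"
    then show "f {x, flip x i} \<in> f ` edges Q" by (intro imageI edge)
  qed
  then have "(\<lambda>i. f {x, flip x i}) ` D = f ` edges Q"
    using card_subset_eq[OF fin] card card_image[OF inj] by metis
  then show "bij_betw (\<lambda>i. f {x, flip x i}) D (f ` edges Q)"
    using inj unfolding bij_betw_def by blast
next
  fix x i
  have "{flip x i, flip (flip x i) i} = {x, flip x i}" by auto
  then show "f {flip x i, flip (flip x i) i} = f {x, flip x i}" by (rule arg_cong)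
qed

lemma factorization_edge_coloring:
  assumes "factorization {x. length x = d} {..<d} {1..d} h"
  obtains g where "proper_n_edge_coloring d (hypercube d) g"
    "\<And>x i. length x = d \<Longrightarrow> i < d \<Longrightarrow> g {x, flip x i} = h x i"
proof -
  have bij: "bij_betw (h x) {..<d} {1..d}" if "length x = d" for x
    using assms that unfolding factorization_def by blast
  have sym: "h (flip x i) i = h x i" if "length x = d" "i < d" for x i
    using assms that unfolding factorization_def by blast
  define g where "g e = (THE c. \<exists>x i. length x = d \<and> i < d \<and> e = {x, flip x i} \<and> c = h x i)" for e
  have g: "g {x, flip x i} = h x i" if xi: "length x = d" "i < d" for x i
    unfolding g_def
  proof (rule the_equality)
    fix c assume "\<exists>y j. length y = d \<and> j < d \<and> {x, flip x i} = {y, flip y j} \<and> c = h y j"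
    then obtain y j where y: "length y = d" "j < d" "{x, flip x i} = {y, flip y j}" "c = h y j"
      by blast
    from y(3) consider "y = x" "flip x i = flip x j" | "y = flip x i" "flip y j = x"
      by (auto simp: doubleton_eq_iff)
    then show "c = h x i"
    proof cases
      case 1 then show ?thesis using y xi flip_inject by metis
    next
      case 2
      then have "flip y j = flip y i" by simp
      then have "j = i" using y flip_inject by metis
      then show ?thesis using 2 y xi sym by simp
    qed
  qed (use xi in blast)
  have "proper_edge_coloring (hypercube d) g"
    unfolding proper_edge_coloring_def
  proof (intro ballI impI, elim conjE)
    fix e e'
    assume e: "e \<in> edges (hypercube d)" "e' \<in> edges (hypercube d)"
      and "e \<noteq> e'" "e \<inter> e' \<noteq> {}"
    then obtain v where v: "v \<in> e" "v \<in> e'" by blast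
    have at: "\<exists>i<d. length v = d \<and> e = {v, flip v i}" 
      if e: "e \<in> edges (hypercube d)" and ve: "v \<in> e" for e
    proof -
      obtain x i where x: "e = {x, flip x i}" "length x = d" "i < d"
        using e unfolding edges_hypercube by blast
      then have "v = x \<or> v = flip x i" using ve by blast
      then have "e = {v, flip v i}" using x by auto
      then show ?thesis using x \<open>v = x \<or> v = flip x i\<close> by auto
    qed
    obtain i j where ij: "length v = d" "i < d" "j < d" "e = {v, flip v i}" "e' = {v, flip v j}"
      using at[OF e(1) v(1)] at[OF e(2) v(2)] by metis
    then have "i \<noteq> j" using \<open>e \<noteq> e'\<close> by blast
    then have "h v i \<noteq> h v j"
      using bij[OF ij(1)] ij(2,3) unfolding bij_betw_def by (auto dest: inj_onD)
    then show "g e \<noteq> g e'"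
      using g ij by simp
  qed
  moreover have "g ` edges (hypercube d) \<subseteq> {1..d}"
  proof (rule image_subsetI)
    fix e assume "e \<in> edges (hypercube d)"
    then obtain x i where "e = {x, flip x i}" "length x = d" "i < d"
      unfolding edges_hypercube by blast
    then show "g e \<in> {1..d}" using g bij_betwE[OF bij] by simp
  qed
  ultimately show thesis using that g unfolding proper_n_edge_coloring_def by blast
qed

section \<open>Extending the colouring of one subcube\<close>

lemma project_in_subcube: "length x = length a \<Longrightarrow> project a D x \<in> subcube a D"
  by (simp add: project_def subcube_def)

lemma project_id:
  assumes "x \<in> subcube a D" shows "project a D x = x"
  using assms by (intro nth_equalityI) (auto simp: project_def subcube_def)

lemma project_flip_in:
  "length x = length a \<Longrightarrow> i \<in> D \<Longrightarrow> i < length a \<Longrightarrow> project a D (flip x i) = flip (project a D x) i"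
  by (intro nth_equalityI) (auto simp: project_def nth_flip)

lemma lift_subcube:
  "x \<in> subcube a D \<Longrightarrow> i \<in> D \<Longrightarrow> lift a D h \<pi> x i = h x i"
  by (simp add: lift_def project_id)

lemma lift_factorization:
  assumes h: "factorization (subcube a D) D A h" and \<pi>: "bij_betw \<pi> (E - D) (C - A)"
    and "D \<subseteq> E" "A \<subseteq> C" "E \<subseteq> {..<length a}"
  shows "factorization {x. length x = length a} E C (lift a D h \<pi>)"
  unfolding factorization_def
proof (intro ballI conjI)
  fix x :: "bool list" assume "x \<in> {x. length x = length a}"
  then have x: "length x = length a" by simp
  have p: "project a D x \<in> subcube a D" using x by (rule project_in_subcube)
  then have "bij_betw (h (project a D x)) D A" using h unfolding factorization_def by blast
  then have "bij_betw (lift a D h \<pi> x) D A"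
    by (simp add: lift_def cong: bij_betw_cong)
  moreover have "bij_betw (lift a D h \<pi> x) (E - D) (C - A)"
    using \<pi> by (subst bij_betw_cong[where g = \<pi>]) (auto simp: lift_def)
  ultimately have "bij_betw (lift a D h \<pi> x) (D \<union> (E - D)) (A \<union> (C - A))"
    by (rule bij_betw_combine) auto
  then show "bij_betw (lift a D h \<pi> x) E C"
    using assms(3,4) by (simp add: Un_absorb1)
  fix i assume "i \<in> E"
  then show "lift a D h \<pi> (flip x i) i = lift a D h \<pi> x i"
    using p h x assms(5) by (auto simp: lift_def project_flip_in factorization_def)
qed

lemma factorization_card:
  "factorization (subcube a D) D A h \<Longrightarrow> card A = card D"
  unfolding factorization_def using base_in_subcube bij_betw_same_card by metis

section \<open>Disjoint subcubes\<close>

text \<open>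
  The directions in \<open>T\<close> cut the cube into blocks, each determined by its coordinates in \<open>T\<close>. Suppose
  that the edges between the blocks are coloured by \<open>K\<close> with colours that depend only on the blocks
  involved. Each block may then be completed on its own with the colours that \<open>K\<close> does not use there.
  The two given subcubes lie in different blocks, so their colourings extend independently.
\<close>

lemma extend_across_cut:
  assumes len: "length a = d" "length b = d"
    and D: "D1 \<subseteq> {..<d} - T" "D2 \<subseteq> {..<d} - T" and T: "T \<subseteq> {..<d}"
    and h1: "factorization (subcube a D1) D1 A1 h"
    and h2: "factorization (subcube b D2) D2 A2 h"
    and t: "t \<in> T" "a ! t \<noteq> b ! t"
    and K_local: "\<And>x y. (\<And>t. t \<in> T \<Longrightarrow> x ! t = y ! t) \<Longrightarrow> K x = K y"
    and K_sym: "\<And>x t. length x = d \<Longrightarrow> t \<in> T \<Longrightarrow> K (flip x t) t = K x t"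
    and K_inj: "\<And>x. inj_on (K x) T" and K_range: "\<And>x. K x ` T \<subseteq> {1..d}"
    and A: "A1 \<subseteq> {1..d} - K a ` T" "A2 \<subseteq> {1..d} - K b ` T"
  obtains g where "factorization {x. length x = d} {..<d} {1..d} g"
    "\<And>x i. x \<in> subcube a D1 \<Longrightarrow> i \<in> D1 \<Longrightarrow> g x i = h x i"
    "\<And>x i. x \<in> subcube b D2 \<Longrightarrow> i \<in> D2 \<Longrightarrow> g x i = h x i"
proof -
  let ?E = "{..<d} - T" and ?C = "\<lambda>x. {1..d} - K x ` T"
  have finT: "finite T" using T finite_subset by blast
  have card_C: "card (?C x) = card ?E" for x
    using T K_range[of x] K_inj[of x] finT by (simp add: card_Diff_subset card_image)
  have ex: "\<exists>\<pi>. bij_betw \<pi> (?E - D) (?C x - B)"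
    if "D \<subseteq> ?E" "B \<subseteq> ?C x" "card B = card D" for D B x
  proof (rule finite_same_card_bij)
    have "finite D" "finite B" using that finite_subset by (blast, blast)
    then show "card (?E - D) = card (?C x - B)"
      using that card_C[of x] by (simp add: card_Diff_subset)
  qed auto
  obtain \<pi>1 where \<pi>1: "bij_betw \<pi>1 (?E - D1) (?C a - A1)"
    using ex[OF D(1) A(1)] factorization_card[OF h1] by blast
  obtain \<pi>2 where \<pi>2: "bij_betw \<pi>2 (?E - D2) (?C b - A2)"
    using ex[OF D(2) A(2)] factorization_card[OF h2] by blast
  \<comment> \<open>In blocks without a prescribed subcube every direction has a constant colour. The choice is made
    from the value of \<open>K x\<close>, so that it is the same for all points of a block.\<close>
  define \<rho> where "\<rho> k = (SOME \<pi>. bij_betw \<pi> ?E ({1..d} - k ` T))" for k :: "nat \<Rightarrow> nat"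
  have \<rho>: "bij_betw (\<rho> (K x)) ?E (?C x)" for x
    using someI_ex[OF ex[of "{}" "{}" x]] by (simp add: \<rho>_def)
  have l1: "factorization {x. length x = d} ?E (?C a) (lift a D1 h \<pi>1)"
    using lift_factorization[OF h1 \<pi>1 D(1) A(1)] len by auto
  have l2: "factorization {x. length x = d} ?E (?C b) (lift b D2 h \<pi>2)"
    using lift_factorization[OF h2 \<pi>2 D(2) A(2)] len by auto
  define blk where "blk c x \<longleftrightarrow> (\<forall>t\<in>T. x ! t = c ! t)" for c x :: "bool list"
  define g where "g x i = (if i \<in> T then K x i else if blk a x then lift a D1 h \<pi>1 x i
     else if blk b x then lift b D2 h \<pi>2 x i else \<rho> (K x) i)" for x i
  have blkK: "K x = K c" if "blk c x" for x c
    using K_local[of x c] that unfolding blk_def by blast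
  have "factorization {x. length x = d} {..<d} {1..d} g"
    unfolding factorization_def
  proof (intro ballI conjI)
    fix x :: "bool list" assume "x \<in> {x. length x = d}"
    then have x: "length x = d" by simp
    have "bij_betw (g x) T (K x ` T)"
      using K_inj[of x] by (subst bij_betw_cong[where g = "K x"]) (auto simp: g_def bij_betw_def)
    moreover have "bij_betw (g x) ?E (?C x)"
    proof -
      consider "blk a x" | "\<not> blk a x" "blk b x" | "\<not> blk a x" "\<not> blk b x" by blast
      then show ?thesis
      proof cases
        case 1
        then have "bij_betw (lift a D1 h \<pi>1 x) ?E (?C x)"
          using l1 x blkK unfolding factorization_def by auto
        then show ?thesis
          using 1 by (subst bij_betw_cong[where g = "lift a D1 h \<pi>1 x"]) (auto simp: g_def)
      next
        case 2
        then have "bij_betw (lift b D2 h \<pi>2 x) ?E (?C x)"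
          using l2 x blkK unfolding factorization_def by auto
        then show ?thesis
          using 2 by (subst bij_betw_cong[where g = "lift b D2 h \<pi>2 x"]) (auto simp: g_def)
      next
        case 3
        then show ?thesis
          using \<rho>[of x] by (subst bij_betw_cong[where g = "\<rho> (K x)"]) (auto simp: g_def)
      qed
    qed
    ultimately have "bij_betw (g x) (T \<union> ?E) (K x ` T \<union> ?C x)"
      by (rule bij_betw_combine) auto
    then show "bij_betw (g x) {..<d} {1..d}"
      using T K_range[of x] by (simp add: Un_absorb1)
    fix i assume i: "i \<in> {..<d}"
    show "g (flip x i) i = g x i"
    proof (cases "i \<in> T")
      case True then show ?thesis using K_sym x by (simp add: g_def)
    next
      case False
      then have same: "flip x i ! t = x ! t" if "t \<in> T" for t using that by (metis nth_flip_neq)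
      then have "blk c (flip x i) = blk c x" for c by (simp add: blk_def)
      moreover have "K (flip x i) = K x" using K_local same by blast
      ultimately show ?thesis
        using l1 l2 i x False by (simp add: g_def factorization_def)
    qed
  qed
  moreover have "g x i = h x i" if "x \<in> subcube a D1" "i \<in> D1" for x i
  proof -
    have "s < length a \<and> s \<notin> D1" if "s \<in> T" for s using that D(1) T len by auto
    then have "blk a x" using subcube_nth[OF that(1)] unfolding blk_def by blast
    then show ?thesis using that D(1) lift_subcube by (auto simp: g_def)
  qed
  moreover have "g x i = h x i" if "x \<in> subcube b D2" "i \<in> D2" for x i
  proof -
    have "s < length b \<and> s \<notin> D2" if "s \<in> T" for s using that D(2) T len by auto
    then have "blk b x" using subcube_nth[OF that(1)] unfolding blk_def by blast
    moreover from this have "\<not> blk a x" using t unfolding blk_def by metis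
    ultimately show ?thesis using that D(2) lift_subcube by (auto simp: g_def)
  qed
  ultimately show thesis using that by blast
qed

text \<open>A single separating direction suffices if it can be coloured with a colour foreign to both subcubes.\<close>

lemma extend_disjoint_spare_color:
  assumes len: "length a = d" "length b = d" and D: "D1 \<subseteq> {..<d}" "D2 \<subseteq> {..<d}"
    and h1: "factorization (subcube a D1) D1 A1 h"
    and h2: "factorization (subcube b D2) D2 A2 h"
    and A: "A1 \<subseteq> {1..d}" "A2 \<subseteq> {1..d}"
    and \<delta>: "\<delta> \<in> {..<d} - (D1 \<union> D2)" "a ! \<delta> \<noteq> b ! \<delta>"
    and c: "c \<in> {1..d} - (A1 \<union> A2)"
  obtains g where "factorization {x. length x = d} {..<d} {1..d} g"
    "\<And>x i. x \<in> subcube a D1 \<Longrightarrow> i \<in> D1 \<Longrightarrow> g x i = h x i"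
    "\<And>x i. x \<in> subcube b D2 \<Longrightarrow> i \<in> D2 \<Longrightarrow> g x i = h x i"
proof (rule extend_across_cut[OF len _ _ _ h1 h2, where T = "{\<delta>}" and K = "\<lambda>x i. c" and t = \<delta>])
qed (use assms that in auto)

text \<open>
  Seen from the quarter of \<open>a\<close>, the edges to its two neighbouring quarters have the colours \<open>\<alpha>\<close> and
  \<open>\<gamma>\<close> outside \<open>A1\<close>; from the opposite quarter, that of \<open>b\<close>, they have the colours \<open>\<beta>\<close> and \<open>\<eta>\<close>
  outside \<open>A2\<close>. Each of the other two quarters sees one colour of either pair.
\<close>

lemma extend_disjoint_far:
  assumes len: "length a = d" "length b = d" and D: "D1 \<subseteq> {..<d}" "D2 \<subseteq> {..<d}"
    and h1: "factorization (subcube a D1) D1 A1 h"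
    and h2: "factorization (subcube b D2) D2 A2 h"
    and A: "A1 \<subseteq> {1..d}" "A2 \<subseteq> {1..d}" "A1 \<union> A2 = {1..d}"
    and \<delta>: "\<delta> \<in> {..<d} - (D1 \<union> D2)" "a ! \<delta> \<noteq> b ! \<delta>"
    and \<epsilon>: "\<epsilon> \<in> {..<d} - (D1 \<union> D2)" "a ! \<epsilon> \<noteq> b ! \<epsilon>" and "\<delta> \<noteq> \<epsilon>"
  obtains g where "factorization {x. length x = d} {..<d} {1..d} g"
    "\<And>x i. x \<in> subcube a D1 \<Longrightarrow> i \<in> D1 \<Longrightarrow> g x i = h x i"
    "\<And>x i. x \<in> subcube b D2 \<Longrightarrow> i \<in> D2 \<Longrightarrow> g x i = h x i"
proof -
  \<comment> \<open>Each subcube has dimension at most \<open>d - 2\<close>, so at least two colours are absent from it.\<close>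
  have two: "\<exists>\<alpha> \<gamma>. \<alpha> \<in> {1..d} - B \<and> \<gamma> \<in> {1..d} - B \<and> \<alpha> \<noteq> \<gamma>"
    if "E \<subseteq> {..<d} - {\<delta>, \<epsilon>}" "B \<subseteq> {1..d}" "card B = card E" for B E
  proof -
    have "card E \<le> card ({..<d} - {\<delta>, \<epsilon>})" using that by (intro card_mono) auto
    moreover have "card ({..<d} - {\<delta>, \<epsilon>}) = d - 2" "2 \<le> d"
      using \<delta> \<epsilon> \<open>\<delta> \<noteq> \<epsilon>\<close> by (auto simp: card_Diff_subset)
    moreover have "card ({1..d} - B) = d - card B"
      using that finite_subset by (subst card_Diff_subset) auto
    ultimately have "2 \<le> card ({1..d} - B)" using that by simp
    then show ?thesis
      by (metis card_le_Suc0_iff_eq finite_Diff finite_atLeastAtMost not_less_eq_eq numeral_2_eq_2)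
  qed
  obtain \<alpha> \<gamma> where \<alpha>: "\<alpha> \<in> {1..d} - A1" "\<gamma> \<in> {1..d} - A1" "\<alpha> \<noteq> \<gamma>"
    using two[of D1 A1] D \<delta> \<epsilon> A factorization_card[OF h1] by blast
  obtain \<beta> \<eta> where \<beta>: "\<beta> \<in> {1..d} - A2" "\<eta> \<in> {1..d} - A2" "\<beta> \<noteq> \<eta>"
    using two[of D2 A2] D \<delta> \<epsilon> A factorization_card[OF h2] by blast
  have disj: "\<alpha> \<noteq> \<eta>" "\<beta> \<noteq> \<gamma>" using \<alpha> \<beta> A by auto
  define K where "K x i = (if i = \<delta> then (if x ! \<epsilon> = a ! \<epsilon> then \<alpha> else \<beta>)
                           else (if x ! \<delta> = a ! \<delta> then \<gamma> else \<eta>))" for x :: "bool list" and i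
  show thesis
  proof (rule extend_across_cut[OF len _ _ _ h1 h2, where T = "{\<delta>, \<epsilon>}" and K = K and t = \<delta>])
    show "K x = K y" if "\<And>t. t \<in> {\<delta>, \<epsilon>} \<Longrightarrow> x ! t = y ! t" for x y
      using that by (auto simp: K_def)
    show "K (flip x t) t = K x t" if "t \<in> {\<delta>, \<epsilon>}" for x t
      using that \<open>\<delta> \<noteq> \<epsilon>\<close> by (auto simp: K_def)
    show "inj_on (K x) {\<delta>, \<epsilon>}" for x
      using \<open>\<delta> \<noteq> \<epsilon>\<close> \<alpha> \<beta> disj by (auto simp: K_def)
    show "K x ` {\<delta>, \<epsilon>} \<subseteq> {1..d}" for x using \<alpha> \<beta> by (auto simp: K_def)
    show "A1 \<subseteq> {1..d} - K a ` {\<delta>, \<epsilon>}" using A \<alpha> \<open>\<delta> \<noteq> \<epsilon>\<close> by (auto simp: K_def)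
    show "A2 \<subseteq> {1..d} - K b ` {\<delta>, \<epsilon>}" using A \<beta> \<open>\<delta> \<noteq> \<epsilon>\<close> \<delta> \<epsilon> by (auto simp: K_def)
  qed (use D \<delta> \<epsilon> that in auto)
qed

section \<open>Intersecting subcubes\<close>

text \<open>
  The colouring of the second subcube is lifted to \<open>l\<close>. The bijection \<open>\<pi>\<close> from transversal
  directions to remaining colours is chosen to map \<open>D1 - D2\<close> onto \<open>A1 - A2\<close>. Then \<open>l\<close> shows exactly
  the colours \<open>A1\<close> on the first subcube, where it can be overwritten by \<open>h\<close>.
\<close>

lemma extend_meeting:
  assumes D: "D1 \<subseteq> {..<length c}" "D2 \<subseteq> {..<length c}"
    and A: "A1 \<subseteq> C" "A2 \<subseteq> C" and C: "finite C" "card C = length c"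
    and h1: "factorization (subcube c D1) D1 A1 h"
    and h2: "factorization (subcube c D2) D2 A2 h"
    and inj: "\<And>x. x \<in> subcube c D1 \<inter> subcube c D2 \<Longrightarrow> inj_on (h x) (D1 \<union> D2)"
  obtains g where "factorization {x. length x = length c} {..<length c} C g"
    "\<And>x i. x \<in> subcube c D1 \<Longrightarrow> i \<in> D1 \<Longrightarrow> g x i = h x i"
    "\<And>x i. x \<in> subcube c D2 \<Longrightarrow> i \<in> D2 \<Longrightarrow> g x i = h x i"
proof -
  have fin: "finite D1" "finite D2" "finite A1" "finite A2"
    using D A C finite_subset by blast+
  \<comment> \<open>Where the subcubes meet, a colour common to both sits on one edge, which therefore lies in both.\<close>
  have common: "h x ` (D1 \<inter> D2) = A1 \<inter> A2" if "x \<in> subcube c D1 \<inter> subcube c D2" for x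
  proof -
    have "h x ` D1 = A1" "h x ` D2 = A2"
      using h1 h2 that unfolding factorization_def bij_betw_def by blast+
    then show ?thesis using inj_on_image_Int[OF inj[OF that], of D1 D2] by simp
  qed
  have "inj_on (h c) (D1 \<inter> D2)" using inj[of c] by (auto intro: inj_on_subset)
  then have card_I: "card (A1 \<inter> A2) = card (D1 \<inter> D2)"
    using common[of c] card_image by fastforce
  have "card (D1 - D2) = card (A1 - A2)"
    using factorization_card[OF h1] card_I fin by (simp add: card_Diff_subset_Int)
  then obtain \<sigma> where \<sigma>: "bij_betw \<sigma> (D1 - D2) (A1 - A2)"
    using finite_same_card_bij fin by blast
  have cardU: "card (D1 \<union> D2) = card (A1 \<union> A2)"
    using card_Un_Int[of D1 D2] card_Un_Int[of A1 A2] fin card_I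
      factorization_card[OF h1] factorization_card[OF h2] by simp
  have "card ({..<length c} - (D1 \<union> D2)) = card (C - (A1 \<union> A2))"
    using cardU D A C fin by (simp add: card_Diff_subset)
  then obtain \<sigma>' where \<sigma>': "bij_betw \<sigma>' ({..<length c} - (D1 \<union> D2)) (C - (A1 \<union> A2))"
    using finite_same_card_bij C by blast
  define \<pi> where "\<pi> i = (if i \<in> D1 then \<sigma> i else \<sigma>' i)" for i
  have \<pi>1: "bij_betw \<pi> (D1 - D2) (A1 - A2)"
    using \<sigma> by (subst bij_betw_cong[where g = \<sigma>]) (auto simp: \<pi>_def)
  have "bij_betw \<pi> ({..<length c} - (D1 \<union> D2)) (C - (A1 \<union> A2))"
    using \<sigma>' by (subst bij_betw_cong[where g = \<sigma>']) (auto simp: \<pi>_def)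
  with \<pi>1 have "bij_betw \<pi> ((D1 - D2) \<union> ({..<length c} - (D1 \<union> D2))) ((A1 - A2) \<union> (C - (A1 \<union> A2)))"
    by (rule bij_betw_combine) auto
  moreover have "(D1 - D2) \<union> ({..<length c} - (D1 \<union> D2)) = {..<length c} - D2"
    "(A1 - A2) \<union> (C - (A1 \<union> A2)) = C - A2"
    using D A by auto
  ultimately have \<pi>: "bij_betw \<pi> ({..<length c} - D2) (C - A2)" by simp
  define l where "l = lift c D2 h \<pi>"
  have l: "factorization {x. length x = length c} {..<length c} C l"
    unfolding l_def using lift_factorization[OF h2 \<pi> D(2) A(2)] by simp
  have l_Q: "l x ` D1 = A1" if x: "x \<in> subcube c D1" for x
  proof -
    \<comment> \<open>Projecting a point of the first subcube to the second one lands in their intersection.\<close>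
    have "project c D2 x \<in> subcube c D1 \<inter> subcube c D2"
      using x by (auto simp: project_def subcube_def)
    then have "h (project c D2 x) ` (D1 \<inter> D2) = A1 \<inter> A2" by (rule common)
    then have "l x ` (D1 \<inter> D2) = A1 \<inter> A2" by (simp add: l_def lift_def)
    moreover have "l x ` (D1 - D2) = A1 - A2"
      using \<pi>1 by (simp add: l_def lift_def bij_betw_def)
    moreover have "l x ` D1 = l x ` (D1 \<inter> D2) \<union> l x ` (D1 - D2)" by blast
    ultimately show ?thesis by blast
  qed
  define g where "g x i = (if x \<in> subcube c D1 \<and> i \<in> D1 then h x i else l x i)" for x i
  have "factorization {x. length x = length c} {..<length c} C g"
    unfolding factorization_def
  proof (intro ballI conjI)
    fix x :: "bool list" assume x: "x \<in> {x. length x = length c}"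
    then have lx: "bij_betw (l x) {..<length c} C" using l unfolding factorization_def by blast
    show "bij_betw (g x) {..<length c} C"
    proof (cases "x \<in> subcube c D1")
      case False
      then have "g x = l x" by (auto simp: g_def)
      then show ?thesis using lx by simp
    next
      case True
      have "bij_betw (h x) D1 A1" using h1 True unfolding factorization_def by blast
      then have 1: "bij_betw (g x) D1 A1"
        using True by (subst bij_betw_cong[where g = "h x"]) (auto simp: g_def)
      have "bij_betw (l x) ({..<length c} - D1) (C - A1)"
      proof -
        have "l x ` ({..<length c} - D1) = C - A1"
          using lx l_Q[OF True] D(1) inj_on_image_set_diff[of "l x" "{..<length c}" "{..<length c}" D1]
          unfolding bij_betw_def by auto
        then show ?thesis using lx by (auto simp: bij_betw_def intro: inj_on_subset)
      qed
      then have "bij_betw (g x) ({..<length c} - D1) (C - A1)"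
        by (subst bij_betw_cong[where g = "l x"]) (auto simp: g_def)
      with 1 have "bij_betw (g x) (D1 \<union> ({..<length c} - D1)) (A1 \<union> (C - A1))"
        by (rule bij_betw_combine) auto
      then show ?thesis using D A by (simp add: Un_absorb1)
    qed
    fix i assume i: "i \<in> {..<length c}"
    have mem: "flip x i \<in> subcube c D1 \<longleftrightarrow> x \<in> subcube c D1" if "i \<in> D1"
      using that flip_in_subcube by (metis flip_flip)
    show "g (flip x i) i = g x i"
      using mem h1 l x i unfolding g_def factorization_def by auto
  qed
  moreover have "g x i = h x i" if "x \<in> subcube c D1" "i \<in> D1" for x i
    using that by (simp add: g_def)
  moreover have "g x i = h x i" if "x \<in> subcube c D2" "i \<in> D2" for x i
    using that lift_subcube by (simp add: g_def l_def)
  ultimately show thesis using that by blast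
qed

section \<open>The relative position of two subcubes and the extension theorem\<close>

text \<open>The witness takes its coordinates in \<open>D1\<close> from \<open>b\<close> and all others from \<open>a\<close>.\<close>

lemma subcubes_meet:
  assumes len: "length b = length a"
    and agree: "\<And>i. i < length a \<Longrightarrow> i \<notin> D1 \<union> D2 \<Longrightarrow> a ! i = b ! i"
  shows "project a D1 b \<in> subcube a D1 \<inter> subcube b D2"
  using assms by (auto simp: project_def subcube_def)

lemma subcubes_adjacent:
  assumes len: "length b = length a"
    and \<delta>: "\<delta> < length a" "\<delta> \<notin> D1 \<union> D2" "a ! \<delta> \<noteq> b ! \<delta>"
    and agree: "\<And>i. i < length a \<Longrightarrow> i \<notin> D1 \<union> D2 \<Longrightarrow> i \<noteq> \<delta> \<Longrightarrow> a ! i = b ! i"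
  shows "flip (project a D1 b) \<delta> \<in> subcube b D2"
  using assms by (auto simp: project_def subcube_def nth_flip)

theorem theorem3p4:
  fixes d k1 k2 :: nat
    and Q R :: "bool list graph"
    and f :: "bool list set \<Rightarrow> nat"
    and A1 A2 :: "nat set"
  assumes "subgraph Q (hypercube d)" and "isomorphic (hypercube k1) Q"
    and "subgraph R (hypercube d)" and "isomorphic (hypercube k2) R"
    and "proper_n_edge_coloring d (graph_union Q R) f"
    and "proper_edge_coloring Q f" and "A1 = f ` edges Q" and "card A1 = k1"
    and "proper_edge_coloring R f" and "A2 = f ` edges R" and "card A2 = k2"
    and "\<not> (verts Q \<inter> verts R = {} \<and>
             (\<exists>u\<in>verts Q. \<exists>v\<in>verts R. {u, v} \<in> edges (hypercube d)) \<and>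
             d \<le> card (A1 \<union> A2))"
  shows "extendable d (graph_union Q R) f"
proof -
  obtain a D1 where Q: "length a = d" "D1 \<subseteq> {..<d}" "card D1 = k1" "verts Q = subcube a D1"
    "edges Q = {{x, flip x i} | x i. x \<in> subcube a D1 \<and> i \<in> D1}"
    using hypercube_copy_is_subcube[OF assms(1,2)] .
  obtain b D2 where R: "length b = d" "D2 \<subseteq> {..<d}" "card D2 = k2" "verts R = subcube b D2"
    "edges R = {{x, flip x i} | x i. x \<in> subcube b D2 \<and> i \<in> D2}"
    using hypercube_copy_is_subcube[OF assms(3,4)] .
  define h where "h x i = f {x, flip x i}" for x i
  have union: "edges (graph_union Q R) = edges Q \<union> edges R" by (simp add: graph_union_def)
  have A: "A1 \<subseteq> {1..d}" "A2 \<subseteq> {1..d}"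
    using assms(5,7,10) unfolding proper_n_edge_coloring_def union by auto
  have finA: "finite A1" "finite A2" using A finite_subset by blast+
  have h1: "factorization (subcube a D1) D1 A1 h"
    using exact_coloring_factorization[OF assms(6) _ Q(5)] Q assms(7,8) finA
    unfolding h_def by simp
  have h2: "factorization (subcube b D2) D2 A2 h"
    using exact_coloring_factorization[OF assms(9) _ R(5)] R assms(10,11) finA
    unfolding h_def by simp
  have "\<exists>g. factorization {x. length x = d} {..<d} {1..d} g \<and>
    (\<forall>x\<in>subcube a D1. \<forall>i\<in>D1. g x i = h x i) \<and> (\<forall>x\<in>subcube b D2. \<forall>i\<in>D2. g x i = h x i)"
  proof (cases "verts Q \<inter> verts R = {}")
    case False
    then obtain c where c: "c \<in> subcube a D1" "c \<in> subcube b D2" unfolding Q(4) R(4) by blast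
    have lenc: "length c = d" using length_subcube[OF c(1)] Q(1) by simp
    have eq: "subcube a D1 = subcube c D1" "subcube b D2 = subcube c D2"
      using subcube_rebase c by blast+
    have inj: "inj_on (h x) (D1 \<union> D2)" if x: "x \<in> subcube c D1 \<inter> subcube c D2" for x
      unfolding h_def
    proof (rule proper_edge_coloring_inj_at)
      show "proper_edge_coloring (graph_union Q R) f"
        using assms(5) by (simp add: proper_n_edge_coloring_def)
      show "{x, flip x i} \<in> edges (graph_union Q R)" if "i \<in> D1 \<union> D2" for i
        using that x unfolding union Q(5) R(5) eq by blast
      show "D1 \<union> D2 \<subseteq> {..<length x}" using x Q(2) R(2) lenc length_subcube[of x c D1] by auto
    qed
    show ?thesis
      by (rule extend_meeting[of D1 c D2 A1 "{1..d}" A2 h])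
         (use Q(2) R(2) A h1 h2 inj lenc eq in auto)
  next
    case True
    \<comment> \<open>If the base points agreed on every coordinate that both cubes hold fixed, the cubes would meet.\<close>
    then obtain \<delta> where \<delta>: "\<delta> \<in> {..<d} - (D1 \<union> D2)" "a ! \<delta> \<noteq> b ! \<delta>"
      using subcubes_meet[of b a D1 D2] Q(1,4) R(1,4) by fastforce
    show ?thesis
    proof (cases "d \<le> card (A1 \<union> A2)")
      case False
      then have "A1 \<union> A2 \<noteq> {1..d}" by auto
      then obtain c where "c \<in> {1..d} - (A1 \<union> A2)" using A by blast
      then show ?thesis
        using extend_disjoint_spare_color[OF Q(1) R(1) Q(2) R(2) h1 h2 A \<delta>] by metis
    next
      case full: True
      have all: "A1 \<union> A2 = {1..d}"
        using full A by (intro card_seteq) auto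
      have "\<exists>\<epsilon>. \<epsilon> \<in> {..<d} - (D1 \<union> D2) \<and> a ! \<epsilon> \<noteq> b ! \<epsilon> \<and> \<delta> \<noteq> \<epsilon>"
      proof (rule ccontr)
        \<comment> \<open>With \<open>\<delta>\<close> as the only separating direction, the point of \<open>Q\<close> closest to \<open>b\<close> has its
          \<open>\<delta>\<close>-neighbour in \<open>R\<close>: this is the excluded configuration.\<close>
        assume none: "\<not> ?thesis"
        let ?u = "project a D1 b"
        have u: "?u \<in> verts Q" using Q(1,4) R(1) project_in_subcube by simp
        have "flip ?u \<delta> \<in> verts R"
          unfolding R(4) by (rule subcubes_adjacent) (use \<delta> none Q(1) R(1) in auto)
        moreover have "{?u, flip ?u \<delta>} \<in> edges (hypercube d)"
          using \<delta> u Q(1,4) length_subcube[of ?u a D1] by (subst hypercube_adjacent_iff) auto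
        ultimately show False using assms(12) True full u by blast
      qed
      then obtain \<epsilon> where "\<epsilon> \<in> {..<d} - (D1 \<union> D2)" "a ! \<epsilon> \<noteq> b ! \<epsilon>" "\<delta> \<noteq> \<epsilon>" by blast
      then show ?thesis
        using extend_disjoint_far[OF Q(1) R(1) Q(2) R(2) h1 h2 A all \<delta>] by metis
    qed
  qed
  then obtain g0 where g0: "factorization {x. length x = d} {..<d} {1..d} g0"
    "\<forall>x\<in>subcube a D1. \<forall>i\<in>D1. g0 x i = h x i" "\<forall>x\<in>subcube b D2. \<forall>i\<in>D2. g0 x i = h x i"
    by blast
  obtain g where g: "proper_n_edge_coloring d (hypercube d) g"
    "\<And>x i. length x = d \<Longrightarrow> i < d \<Longrightarrow> g {x, flip x i} = g0 x i"
    using factorization_edge_coloring[OF g0(1)] by blast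
  have "g e = f e" if e: "e \<in> edges Q \<union> edges R" for e
  proof -
    obtain x i where "e = {x, flip x i}" "x \<in> subcube a D1 \<and> i \<in> D1 \<or> x \<in> subcube b D2 \<and> i \<in> D2"
      using e unfolding Q(5) R(5) by blast
    moreover from this have "length x = d" "i < d" using Q(1,2) R(1,2) by (auto simp: length_subcube)
    ultimately show ?thesis using g(2) g0 by (auto simp: h_def)
  qed
  then show ?thesis using g(1) unfolding extendable_def union by blast
qed

end
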